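(* For every weighted graph $G=(V,E,w)$ with $n$ vertices, and for every $0<\epsilon<1$, there is a set $S\subseteq V$ of size at least $\epsilon n/42$ such that $\epsilon L\succcurlyeq L_S$, i.e. $\epsilon L-L_S$ is positive semidefinite.
   Context: $G$ is a finite undirected graph with positive edge weights $w(s,t)$. Its Laplacian is $L=\sum_{(s,t)\in E}w(s,t)(\delta_s-\delta_t)(\delta_s-\delta_t)^T$, where $\delta_s$ is the elementary unit vector with a $1$ in position $s$. For $S\subseteq V$, $G_S$ is the graph with the same vertex set $V$ but only those (weighted) edges of $G$ both of whose endpoints lie in $S$, and $L_S$ is the Laplacian of $G_S$ (an $n\times n$ matrix). *)

theory Defs
  imports "HOL-Analysis.Analysis" "HOL-Library.Uprod"
begin

text \<open>
  The vertex set is the finite type \<open>'v\<close>, so \<open>n = CARD('v)\<close>, and matrices are indexed by vertices.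
  An undirected edge is an unordered pair \<open>Upair s t\<close>, so each edge occurs once in the sums below.
  Loops \<open>Upair s s\<close> are not excluded; they contribute the zero matrix to every Laplacian.
\<close>

definition outer_product :: "real ^ 'v \<Rightarrow> real ^ 'v \<Rightarrow> real ^ 'v ^ 'v" where
  "outer_product x y = (\<chi> i j. x $ i * y $ j)"

lift_definition edge_matrix :: "'v::finite uprod \<Rightarrow> real ^ 'v ^ 'v" is
  "\<lambda>(s, t). outer_product (axis s 1 - axis t 1) (axis s 1 - axis t 1)"
  by (auto simp: eq_upair_def outer_product_def vec_eq_iff algebra_simps)

definition laplacian :: "'v::finite uprod set \<Rightarrow> ('v uprod \<Rightarrow> real) \<Rightarrow> real ^ 'v ^ 'v" where
  "laplacian E w = (\<Sum>e\<in>E. w e *\<^sub>R edge_matrix e)"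

lemma edge_matrix_Upair:
  "edge_matrix (Upair s t) = outer_product (axis s 1 - axis t 1) (axis s 1 - axis t 1)"
  by transfer simp

definition edges_within :: "'v uprod set \<Rightarrow> 'v set \<Rightarrow> 'v uprod set" where
  "edges_within E S = {e \<in> E. set_uprod e \<subseteq> S}"

definition pos_semidef :: "real ^ 'v ^ 'v::finite \<Rightarrow> bool" where
  "pos_semidef A \<longleftrightarrow> transpose A = A \<and> (\<forall>x. 0 \<le> x \<bullet> (A *v x))"

end

theory Submission
  imports Defs
begin

text \<open>
  After normalizing \<open>L\<close> to the identity, the edges become vectors \<open>r e\<close> with
  \<open>\<Sum>e. r e r e\<^sup>T \<le> I\<close>, and a set \<open>S\<close> with \<open>M = \<Sum>e\<subseteq>S. r e r e\<^sup>T \<le> \<epsilon> I\<close> is wanted. It is grown one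
  vertex at a time by the barrier method of Batson, Spielman and Srivastava: a barrier \<open>u\<close> moves from
  \<open>\<epsilon> / 2\<close> to \<open>\<epsilon>\<close> while the potential \<open>tr (u I - M)\<inverse> - n / u\<close>, which vanishes for \<open>M = 0\<close>, stays
  \<open>O(n)\<close>. Subtracting \<open>n / u\<close> is what makes the bound linear in \<open>\<epsilon>\<close>: averaged over the candidates \<open>t\<close>,
  the cost of the edges between \<open>t\<close> and \<open>S\<close> is at most the potential plus the trace of the
  boundary of \<open>S\<close> divided by \<open>u\<close>, and the latter trace is at most \<open>4 |S|\<close> if only vertices of
  leverage degree at most 4 are used.
\<close>

text \<open>Unordered pairs index the edge vectors; finiteness lets them serve as the coordinate
  type \<open>'e\<close> in \<open>isotropic_position\<close>.\<close>

instance uprod :: (finite) finite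
  by standard simp

section \<open>Positive definite matrices\<close>

definition pos_def :: "real ^ 'n ^ 'n::finite \<Rightarrow> bool" where
  "pos_def A \<longleftrightarrow> transpose A = A \<and> (\<forall>x. x \<noteq> 0 \<longrightarrow> 0 < x \<bullet> (A *v x))"

definition gram :: "('e \<Rightarrow> real ^ 'n) \<Rightarrow> 'e set \<Rightarrow> real ^ 'n ^ 'n" where
  "gram r F = (\<Sum>e\<in>F. outer_product (r e) (r e))"

section \<open>Quadratic forms of outer products and Gram matrices\<close>

lemma outer_product_mult_vec:
  "outer_product x y *v z = (y \<bullet> z) *\<^sub>R x"
  for x y z :: "real ^ 'n::finite"
  by (simp add: vec_eq_iff outer_product_def matrix_vector_mult_def inner_vec_def
      sum_distrib_left sum_distrib_right mult_ac)

lemma transpose_outer_product: "transpose (outer_product x x) = outer_product x x"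
  by (simp add: vec_eq_iff outer_product_def transpose_def mult.commute)

lemma transpose_sum: "transpose (\<Sum>e\<in>F. f e) = (\<Sum>e\<in>F. transpose (f e))"
  for f :: "'e \<Rightarrow> real ^ 'n ^ 'm"
  by (simp add: vec_eq_iff transpose_def)

lemma sum_matrix_vector_mult: "(\<Sum>e\<in>F. f e) *v x = (\<Sum>e\<in>F. f e *v x)"
  for f :: "'e \<Rightarrow> real ^ 'n ^ 'm" and x :: "real ^ 'n::finite"
  by (induction F rule: infinite_finite_induct) (auto simp: matrix_vector_mult_add_rdistrib)

lemma scaleR_matrix_vector_mult: "(c *\<^sub>R A) *v x = c *\<^sub>R (A *v x)"
  for A :: "real ^ 'n ^ 'm" and x :: "real ^ 'n::finite"
  by (simp add: scaleR_matrix_vector_assoc)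

lemma transpose_gram: "transpose (gram r F) = gram r F"
  by (simp add: gram_def transpose_sum transpose_outer_product)

lemma inner_gram: "x \<bullet> (gram r F *v y) = (\<Sum>e\<in>F. (r e \<bullet> x) * (r e \<bullet> y))"
  for x y :: "real ^ 'n::finite"
  by (simp add: gram_def sum_matrix_vector_mult outer_product_mult_vec inner_sum_right
      inner_commute mult.commute)

lemma symmetric_inner:
  fixes A :: "real ^ 'n ^ 'n::finite"
  assumes "transpose A = A"
  shows "x \<bullet> (A *v y) = (A *v x) \<bullet> y"
  by (metis assms dot_lmul_matrix transpose_matrix_vector)

lemma trace_eq_sum_axis: "trace Y = (\<Sum>i\<in>UNIV. axis i 1 \<bullet> (Y *v axis i 1))"
  for Y :: "real ^ 'n ^ 'n::finite"
  by (simp add: trace_def inner_axis' matrix_vector_mult_basis column_def)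

lemma trace_scaleR: "trace (c *\<^sub>R Y) = c * trace Y"
  for Y :: "real ^ 'n ^ 'n::finite"
  by (simp add: trace_def sum_distrib_left)

lemma matrix_add_rdistrib: "(A + B) ** C = A ** C + B ** C"
  for A B :: "real ^ 'm ^ 'n" and C :: "real ^ 'k ^ 'm"
  by (simp add: vec_eq_iff matrix_matrix_mult_def sum.distrib distrib_right)

section \<open>Inverses of positive definite matrices\<close>

lemma pos_def_invertible:
  assumes "pos_def A"
  shows "invertible A"
proof -
  have "\<forall>x. A *v x = 0 \<longrightarrow> x = 0"
    using assms unfolding pos_def_def by (metis inner_zero_right less_irrefl)
  then show ?thesis
    using invertible_left_inverse matrix_left_invertible_ker by blast
qed

lemma matrix_inv_mult:
  assumes "pos_def A"
  shows "A ** matrix_inv A = mat 1" "matrix_inv A ** A = mat 1"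
  using pos_def_invertible[OF assms] unfolding invertible_def matrix_inv_def
  by (metis (mono_tags, lifting) someI_ex)+

lemma matrix_inv_mult_vec:
  assumes "pos_def A"
  shows "A *v (matrix_inv A *v x) = x" "matrix_inv A *v (A *v x) = x"
  using matrix_inv_mult[OF assms] by (simp_all add: matrix_vector_mul_assoc)

lemma transpose_matrix_inv:
  assumes "pos_def A"
  shows "transpose (matrix_inv A) = matrix_inv A"
proof -
  have "transpose (matrix_inv A) ** A = mat 1"
    using matrix_inv_mult(1)[OF assms] assms unfolding pos_def_def
    by (metis matrix_transpose_mul transpose_mat)
  then show ?thesis
    using matrix_inv_mult(1)[OF assms]
    by (metis matrix_mul_assoc matrix_mul_lid matrix_mul_rid)
qed

lemma pos_def_matrix_inv:
  assumes "pos_def A"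
  shows "pos_def (matrix_inv A)"
  unfolding pos_def_def
proof (intro conjI allI impI)
  show "transpose (matrix_inv A) = matrix_inv A"
    by (rule transpose_matrix_inv[OF assms])
  fix x :: "real ^ 'a" assume "x \<noteq> 0"
  define z where "z = matrix_inv A *v x"
  have x: "x = A *v z"
    by (simp add: z_def matrix_inv_mult_vec[OF assms])
  with \<open>x \<noteq> 0\<close> have "z \<noteq> 0" by auto
  then have "0 < z \<bullet> (A *v z)"
    using assms unfolding pos_def_def by blast
  then show "0 < x \<bullet> (matrix_inv A *v x)"
    by (simp add: x[symmetric] z_def[symmetric] inner_commute)
qed

section \<open>Comparing inverses without eigenvalues\<close>

lemma pos_def_nonneg: "pos_def A \<Longrightarrow> 0 \<le> x \<bullet> (A *v x)"
  unfolding pos_def_def by (cases "x = 0") (auto intro: less_imp_le)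

text \<open>The gap between the two sides is the form of \<open>A\<close> at
  \<open>z - matrix_inv A *v y\<close>. Test vectors \<open>z\<close> thus bound the inverse from
  below without diagonalization.\<close>

lemma inverse_variational:
  assumes "pos_def A"
  shows "2 * (y \<bullet> z) - z \<bullet> (A *v z) \<le> y \<bullet> (matrix_inv A *v y)"
proof -
  define x where "x = matrix_inv A *v y"
  have y: "y = A *v x"
    by (simp add: x_def matrix_inv_mult_vec[OF assms])
  have sym: "x \<bullet> (A *v z) = z \<bullet> (A *v x)"
    using assms symmetric_inner[of A x z] by (simp add: pos_def_def inner_commute)
  have "0 \<le> (z - x) \<bullet> (A *v (z - x))"
    by (rule pos_def_nonneg[OF assms])
  also have "\<dots> = z \<bullet> (A *v z) - 2 * (y \<bullet> z) + y \<bullet> x"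
    using sym by (simp add: matrix_vector_mult_diff_distrib inner_diff_left inner_diff_right y
      inner_commute)
  finally show ?thesis by (simp add: x_def)
qed

text \<open>Cauchy-Schwarz for the norm of \<open>A\<close> and its dual, from optimizing the scale
  of \<open>z\<close> in \<open>inverse_variational\<close>. It serves to dominate a rank-one term
  by a multiple of \<open>A\<close>.\<close>

lemma inner_square_le_inverse:
  assumes "pos_def A"
  shows "(y \<bullet> z)\<^sup>2 \<le> (z \<bullet> (A *v z)) * (y \<bullet> (matrix_inv A *v y))"
proof (cases "z = 0")
  case False
  define q where "q = z \<bullet> (A *v z)"
  have q: "q > 0" using assms False by (simp add: pos_def_def q_def)
  have "2 * (y \<bullet> (((y \<bullet> z) / q) *\<^sub>R z)) - (((y \<bullet> z) / q) *\<^sub>R z) \<bullet> (A *v (((y \<bullet> z) / q) *\<^sub>R z))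
      = (y \<bullet> z)\<^sup>2 / q"
    using q by (simp add: matrix_vector_mult_scaleR q_def[symmetric] power2_eq_square field_simps)
  with inverse_variational[OF assms, of y "((y \<bullet> z) / q) *\<^sub>R z"]
  have "(y \<bullet> z)\<^sup>2 / q \<le> y \<bullet> (matrix_inv A *v y)" by simp
  then show ?thesis using q by (simp add: q_def[symmetric] field_simps)
qed simp

text \<open>The test vector \<open>(1 / c) *\<^sub>R y\<close> gives the first bound, and
  Cauchy-Schwarz turns it into the second.\<close>

lemma inverse_lower_bound:
  fixes A :: "real ^ 'n ^ 'n::finite"
  assumes "pos_def A" and "c > 0" and le: "\<And>x. x \<bullet> (A *v x) \<le> c * (x \<bullet> x)"
  shows "(y \<bullet> y) / c \<le> y \<bullet> (matrix_inv A *v y)"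
    and "(y \<bullet> y) / c\<^sup>2 \<le> (matrix_inv A *v y) \<bullet> (matrix_inv A *v y)"
proof -
  have "2 * (y \<bullet> ((1 / c) *\<^sub>R y)) - ((1 / c) *\<^sub>R y) \<bullet> (A *v ((1 / c) *\<^sub>R y))
      \<ge> 2 * (y \<bullet> y) / c - c * (((1 / c) *\<^sub>R y) \<bullet> ((1 / c) *\<^sub>R y))"
    using le[of "(1 / c) *\<^sub>R y"] by simp
  moreover have "2 * (y \<bullet> y) / c - c * (((1 / c) *\<^sub>R y) \<bullet> ((1 / c) *\<^sub>R y)) = (y \<bullet> y) / c"
    using \<open>c > 0\<close> by (simp add: field_simps)
  ultimately show *: "(y \<bullet> y) / c \<le> y \<bullet> (matrix_inv A *v y)"
    using inverse_variational[OF assms(1), of y "(1 / c) *\<^sub>R y"] by linarith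
  show "(y \<bullet> y) / c\<^sup>2 \<le> (matrix_inv A *v y) \<bullet> (matrix_inv A *v y)"
  proof (cases "y = 0")
    case False
    have "norm y * (norm y / c) \<le> norm y * norm (matrix_inv A *v y)"
      using * norm_cauchy_schwarz[of y "matrix_inv A *v y"]
      by (simp add: dot_square_norm power2_eq_square)
    then have "norm y / c \<le> norm (matrix_inv A *v y)"
      using False by (metis mult_le_cancel_left_pos zero_less_norm_iff)
    then have "(norm y / c)\<^sup>2 \<le> (norm (matrix_inv A *v y))\<^sup>2"
      using \<open>c > 0\<close> by (intro power_mono) auto
    then show ?thesis by (simp add: dot_square_norm power_divide)
  qed simp
qed

lemma pos_semidef_inverse_minus:
  fixes A :: "real ^ 'n ^ 'n::finite"
  assumes "pos_def A" and "c > 0" and "\<And>x. x \<bullet> (A *v x) \<le> c * (x \<bullet> x)"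
  shows "pos_semidef (matrix_inv A - (1 / c) *\<^sub>R mat 1)"
    and "pos_semidef (matrix_inv A ** matrix_inv A - (1 / c\<^sup>2) *\<^sub>R mat 1)"
proof -
  have t: "transpose (X - Y) = transpose X - transpose Y"
      "transpose (a *\<^sub>R X) = a *\<^sub>R transpose X" for a and X Y :: "real ^ 'n ^ 'n"
    by (simp_all add: transpose_def vec_eq_iff)
  show "pos_semidef (matrix_inv A - (1 / c) *\<^sub>R mat 1)"
    unfolding pos_semidef_def
    using inverse_lower_bound(1)[OF assms]
    by (simp add: t transpose_matrix_inv[OF assms(1)] matrix_vector_mult_diff_rdistrib
        scaleR_matrix_vector_mult inner_diff_right)
  show "pos_semidef (matrix_inv A ** matrix_inv A - (1 / c\<^sup>2) *\<^sub>R mat 1)"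
    unfolding pos_semidef_def
    using inverse_lower_bound(2)[OF assms]
    by (simp add: t transpose_matrix_inv[OF assms(1)] matrix_vector_mult_diff_rdistrib
        scaleR_matrix_vector_mult inner_diff_right matrix_transpose_mul
        symmetric_inner[OF transpose_matrix_inv[OF assms(1)], symmetric]
        flip: matrix_vector_mul_assoc)
qed

section \<open>The barrier function\<close>

lemma trace_inverse_square:
  assumes "pos_def A"
  shows "trace (matrix_inv A ** matrix_inv A)
    = (\<Sum>i\<in>UNIV. (matrix_inv A *v axis i 1) \<bullet> (matrix_inv A *v axis i 1))"
  by (simp add: trace_eq_sum_axis symmetric_inner[OF transpose_matrix_inv[OF assms]]
      flip: matrix_vector_mul_assoc)

lemma pos_semidef_trace_nonneg:
  assumes "pos_semidef Y"
  shows "0 \<le> trace Y"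
  using assms unfolding trace_eq_sum_axis pos_semidef_def by (intro sum_nonneg) blast

lemma trace_inverse_square_ge:
  fixes A :: "real ^ 'n ^ 'n::finite"
  assumes "pos_def A" and "c > 0" and "\<And>x. x \<bullet> (A *v x) \<le> c * (x \<bullet> x)"
  shows "real CARD('n) / c\<^sup>2 \<le> trace (matrix_inv A ** matrix_inv A)"
  using pos_semidef_trace_nonneg[OF pos_semidef_inverse_minus(2)[OF assms]]
  by (simp add: trace_sub trace_scaleR trace_I)

text \<open>
  Since the potential is measured relative to its value at the zero matrix, the gain from raising
  the barrier is governed by the excess of \<open>trace (X' ** X')\<close> over its own value at the zero matrix.
\<close>

lemma barrier_shift:
  fixes A :: "real ^ 'n ^ 'n::finite"
  assumes A: "pos_def A" and A': "pos_def (A + \<delta> *\<^sub>R mat 1)" and "u > 0" "\<delta> \<ge> 0"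
    and le: "\<And>x. x \<bullet> (A *v x) \<le> u * (x \<bullet> x)"
  defines "X' \<equiv> matrix_inv (A + \<delta> *\<^sub>R mat 1)"
  shows "trace X' - real CARD('n) / (u + \<delta>)
      + \<delta> * (trace (X' ** X') - real CARD('n) / (u + \<delta>)\<^sup>2)
    \<le> trace (matrix_inv A) - real CARD('n) / u"
proof -
  define X where "X = matrix_inv A"
  have le': "x \<bullet> ((A + \<delta> *\<^sub>R mat 1) *v x) \<le> (u + \<delta>) * (x \<bullet> x)" for x
    using le[of x] by (simp add: matrix_vector_mult_add_rdistrib scaleR_matrix_vector_mult
        inner_add_right algebra_simps)
  \<comment> \<open>The resolvent identity, used twice, expands \<open>trace X\<close> in \<delta>
    up to a second-order remainder \<open>trace (X ** X' ** X')\<close>.\<close>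
  have "X = X ** (A + \<delta> *\<^sub>R mat 1) ** X'"
    using matrix_inv_mult(1)[OF A'] by (simp add: X'_def flip: matrix_mul_assoc)
  also have "X ** (A + \<delta> *\<^sub>R mat 1) = mat 1 + \<delta> *\<^sub>R X"
    using matrix_inv_mult(2)[OF A]
    by (simp add: X_def matrix_add_ldistrib matrix_scalar_ac flip: scalar_matrix_assoc)
  also have "(mat 1 + \<delta> *\<^sub>R X) ** X' = X' + \<delta> *\<^sub>R (X ** X')"
    by (simp add: matrix_add_rdistrib flip: scalar_matrix_assoc)
  finally have resolvent: "X = X' + \<delta> *\<^sub>R (X ** X')" .
  then have "X ** X' = X' ** X' + \<delta> *\<^sub>R (X ** X' ** X')"
    by (metis matrix_add_rdistrib scalar_matrix_assoc)
  then have tr1: "trace (X ** X') = trace (X' ** X') + \<delta> * trace (X ** X' ** X')"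
    by (metis trace_add trace_scaleR)
  have tr: "trace X = trace X' + \<delta> * trace (X ** X')"
    by (metis resolvent trace_add trace_scaleR)
  \<comment> \<open>The remainder is at least its value at the zero matrix: \<open>X\<close>
    dominates \<open>1 / u\<close> times the identity, and \<open>trace (X' ** X')\<close> has its
    own lower bound.\<close>
  have "real CARD('n) / (u + \<delta>)\<^sup>2 / u \<le> trace (X' ** X') / u"
    using trace_inverse_square_ge[OF A' _ le'] \<open>u > 0\<close> \<open>\<delta> \<ge> 0\<close>
    by (intro divide_right_mono) (auto simp: X'_def)
  also have "\<dots> = (\<Sum>i\<in>UNIV. ((X' *v axis i 1) \<bullet> (X' *v axis i 1)) / u)"
    using trace_inverse_square[OF A'] by (simp add: X'_def sum_divide_distrib)
  also have "\<dots> \<le> (\<Sum>i\<in>UNIV. (X' *v axis i 1) \<bullet> (X *v (X' *v axis i 1)))"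
    unfolding X_def by (intro sum_mono inverse_lower_bound(1)[OF A \<open>u > 0\<close> le])
  also have "\<dots> = trace (X' ** (X ** X'))"
    by (simp add: trace_eq_sum_axis X'_def symmetric_inner[OF transpose_matrix_inv[OF A']]
        flip: matrix_vector_mul_assoc)
  also have "\<dots> = trace (X ** X' ** X')"
    by (rule trace_mul_sym)
  finally have "\<delta> * \<delta> * (real CARD('n) / (u + \<delta>)\<^sup>2 / u) \<le> \<delta> * \<delta> * trace (X ** X' ** X')"
    by (intro mult_left_mono) auto
  \<comment> \<open>The same expansion with \<open>A\<close> equal to \<open>u\<close> times the
    identity; subtracting it passes to the normalized potential.\<close>
  moreover have "real CARD('n) / u - real CARD('n) / (u + \<delta>)
      = \<delta> * \<delta> * (real CARD('n) / (u + \<delta>)\<^sup>2 / u) + \<delta> * (real CARD('n) / (u + \<delta>)\<^sup>2)"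
    using \<open>u > 0\<close> \<open>\<delta> \<ge> 0\<close> by (simp add: divide_simps add_pos_nonneg) algebra
  ultimately show ?thesis
    using tr tr1 by (simp add: X_def[symmetric] algebra_simps)
qed

text \<open>Convexity of squaring, for \<open>a / (1 - \<theta>)\<close> and
  \<open>b / \<theta>\<close> with weights \<open>1 - \<theta>\<close> and \<theta>.\<close>

lemma young_square:
  fixes a b \<theta> :: real
  assumes "0 < \<theta>" "\<theta> < 1"
  shows "(a + b)\<^sup>2 \<le> a\<^sup>2 / (1 - \<theta>) + b\<^sup>2 / \<theta>"
proof -
  have "a\<^sup>2 / (1 - \<theta>) + b\<^sup>2 / \<theta> - (a + b)\<^sup>2 = (\<theta> * a - (1 - \<theta>) * b)\<^sup>2 / (\<theta> * (1 - \<theta>))"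
    using assms by (simp add: divide_simps) algebra
  moreover have "\<dots> \<ge> 0" using assms by simp
  ultimately show ?thesis by linarith
qed

text \<open>Stands in for the Sherman-Morrison formula when several rank-one terms are removed at
  once. By \<open>inner_square_le_inverse\<close> their sum is at most \<theta> times
  \<open>A\<close>, so a fraction \<open>1 - \<theta>\<close> of \<open>A\<close> survives and the
  first-order cost is inflated by at most \<open>1 / (1 - \<theta>)\<close>.\<close>

lemma gram_update:
  fixes A :: "real ^ 'n ^ 'n::finite" and r :: "'e \<Rightarrow> real ^ 'n" and F :: "'e set"
  assumes A: "pos_def A"
  defines "X \<equiv> matrix_inv A"
  defines "\<theta> \<equiv> \<Sum>e\<in>F. r e \<bullet> (X *v r e)"
  assumes "\<theta> < 1"
  shows "pos_def (A - gram r F)" (is "pos_def ?C")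
    and "trace (matrix_inv (A - gram r F))
      \<le> trace X + (\<Sum>e\<in>F. (X *v r e) \<bullet> (X *v r e)) / (1 - \<theta>)"
proof -
  have quad: "x \<bullet> (?C *v x) = x \<bullet> (A *v x) - (\<Sum>e\<in>F. (r e \<bullet> x)\<^sup>2)" for x
    by (simp add: matrix_vector_mult_diff_rdistrib inner_diff_right inner_gram power2_eq_square)
  have B_le: "(\<Sum>e\<in>F. (r e \<bullet> x)\<^sup>2) \<le> \<theta> * (x \<bullet> (A *v x))" for x
  proof -
    have "(\<Sum>e\<in>F. (r e \<bullet> x)\<^sup>2) \<le> (\<Sum>e\<in>F. (x \<bullet> (A *v x)) * (r e \<bullet> (X *v r e)))"
      unfolding X_def by (intro sum_mono inner_square_le_inverse A)
    then show ?thesis by (simp add: \<theta>_def sum_distrib_left mult.commute)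
  qed
  have "\<theta> \<ge> 0"
    unfolding \<theta>_def X_def by (intro sum_nonneg pos_def_nonneg pos_def_matrix_inv A)
  show C: "pos_def ?C"
    unfolding pos_def_def
  proof (intro conjI allI impI)
    show "transpose ?C = ?C"
      using A transpose_gram[of r F] by (simp add: pos_def_def transpose_def vec_eq_iff)
    fix x :: "real ^ 'n" assume "x \<noteq> 0"
    then have "0 < x \<bullet> (A *v x)" using A by (simp add: pos_def_def)
    then have "\<theta> * (x \<bullet> (A *v x)) < x \<bullet> (A *v x)" using \<open>\<theta> < 1\<close> by simp
    then show "0 < x \<bullet> (?C *v x)" using B_le[of x] by (simp add: quad)
  qed
  have sq_le: "(\<Sum>e\<in>F. (r e \<bullet> (x + d))\<^sup>2)
      \<le> (\<Sum>e\<in>F. (r e \<bullet> x)\<^sup>2) / (1 - \<theta>) + d \<bullet> (A *v d)" for x d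
  \<comment> \<open>Young's inequality divides by \<theta>. If \<theta> is 0, \<open>B_le\<close>
    kills every \<open>r e \<bullet> d\<close>; for infinite \<open>F\<close> the sums are 0 by
    convention.\<close>
  proof (cases "\<theta> = 0")
    case True
    have "(r e \<bullet> d)\<^sup>2 = 0" if "e \<in> F" "finite F" for e
      using B_le[of d] True that
      by (metis (no_types, lifting) antisym mult_zero_left sum_nonneg sum_nonneg_0
          zero_le_power2)
    then have "(\<Sum>e\<in>F. (r e \<bullet> (x + d))\<^sup>2) = (\<Sum>e\<in>F. (r e \<bullet> x)\<^sup>2)"
      by (cases "finite F") (auto intro!: sum.cong simp: inner_add_right)
    then show ?thesis using True pos_def_nonneg[OF A, of d] by simp
  next
    case False
    with \<open>\<theta> \<ge> 0\<close> have "\<theta> > 0" by simp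
    have "(\<Sum>e\<in>F. (r e \<bullet> (x + d))\<^sup>2)
        \<le> (\<Sum>e\<in>F. (r e \<bullet> x)\<^sup>2 / (1 - \<theta>) + (r e \<bullet> d)\<^sup>2 / \<theta>)"
      unfolding inner_add_right using \<open>\<theta> > 0\<close> \<open>\<theta> < 1\<close> by (intro sum_mono young_square)
    also have "\<dots> = (\<Sum>e\<in>F. (r e \<bullet> x)\<^sup>2) / (1 - \<theta>) + (\<Sum>e\<in>F. (r e \<bullet> d)\<^sup>2) / \<theta>"
      by (simp add: sum.distrib sum_divide_distrib)
    also have "(\<Sum>e\<in>F. (r e \<bullet> d)\<^sup>2) / \<theta> \<le> d \<bullet> (A *v d)"
      using B_le[of d] \<open>\<theta> > 0\<close> by (simp add: field_simps)
    finally show ?thesis by simp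
  qed
  \<comment> \<open>With \<open>x = A\<inverse> y\<close> and \<open>x + d = C\<inverse> y\<close> this is a Young inequality for the form \<open>B = A - C\<close>,
    whose \<open>d\<close>-part is absorbed by \<open>B \<le> \<theta> A\<close>.\<close>
  have inv_le: "y \<bullet> (matrix_inv ?C *v y)
      \<le> y \<bullet> (X *v y) + (\<Sum>e\<in>F. (r e \<bullet> (X *v y))\<^sup>2) / (1 - \<theta>)" for y
  proof -
    define z where "z = matrix_inv ?C *v y"
    define x where "x = X *v y"
    define d where "d = z - x"
    have y: "y = ?C *v z" "y = A *v x"
      by (simp_all add: x_def X_def z_def matrix_inv_mult_vec[OF A] matrix_inv_mult_vec[OF C])
    have "z = x + d" by (simp add: d_def)
    have sym: "x \<bullet> (A *v d) = d \<bullet> (A *v x)"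
      using A symmetric_inner[of A x d] by (simp add: pos_def_def inner_commute)
    have "y \<bullet> z = 2 * (y \<bullet> z) - z \<bullet> (?C *v z)"
      by (simp add: y(1)[symmetric] inner_commute)
    also have "\<dots> = y \<bullet> x - d \<bullet> (A *v d) + (\<Sum>e\<in>F. (r e \<bullet> (x + d))\<^sup>2)"
      using sym unfolding quad \<open>z = x + d\<close>
      by (simp add: y(2) matrix_vector_right_distrib inner_add_left inner_add_right inner_commute)
    also have "\<dots> \<le> y \<bullet> x + (\<Sum>e\<in>F. (r e \<bullet> x)\<^sup>2) / (1 - \<theta>)"
      using sq_le[of x d] by linarith
    finally show ?thesis by (simp add: z_def x_def)
  qed
  have "trace (matrix_inv ?C)
      \<le> (\<Sum>i\<in>UNIV. axis i 1 \<bullet> (X *v axis i 1) + (\<Sum>e\<in>F. (r e \<bullet> (X *v axis i 1))\<^sup>2) / (1 - \<theta>))"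
    unfolding trace_eq_sum_axis by (intro sum_mono inv_le)
  also have "\<dots> = trace X + (\<Sum>e\<in>F. \<Sum>i\<in>UNIV. (r e \<bullet> (X *v axis i 1))\<^sup>2) / (1 - \<theta>)"
    by (simp add: sum.distrib trace_eq_sum_axis sum.swap[of _ F] flip: sum_divide_distrib)
  also have "(\<Sum>e\<in>F. \<Sum>i\<in>UNIV. (r e \<bullet> (X *v axis i 1))\<^sup>2) = (\<Sum>e\<in>F. (X *v r e) \<bullet> (X *v r e))"
  proof -
    have "r e \<bullet> (X *v axis i 1) = (X *v r e) $ i" for e i
      using symmetric_inner[OF transpose_matrix_inv[OF A], of "r e" "axis i 1"]
      by (simp add: X_def inner_axis)
    then show ?thesis by (simp add: inner_vec_def power2_eq_square)
  qed
  finally show "trace (matrix_inv ?C) \<le> trace X + (\<Sum>e\<in>F. (X *v r e) \<bullet> (X *v r e)) / (1 - \<theta>)" .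
qed

section \<open>Isotropic position\<close>

text \<open>
  The vectors \<open>r e\<close> are the coordinates of the projections of the unit vectors onto the range of
  \<open>x \<mapsto> (q e \<bullet> x)\<^sub>e\<close>, in an orthonormal basis that is padded by zeros to the index type \<open>'n\<close>. This
  normalizes \<open>\<Sum>e. q e q e\<^sup>T\<close> to the identity without inverting it, so it may be singular.
\<close>

lemma isotropic_position:
  fixes q :: "'e::finite \<Rightarrow> real ^ 'n::finite"
  obtains r :: "'e \<Rightarrow> real ^ 'n" where
    "\<And>Y. pos_semidef Y \<Longrightarrow> (\<Sum>e\<in>UNIV. r e \<bullet> (Y *v r e)) \<le> trace Y"
    "\<And>e. q e = 0 \<Longrightarrow> r e = 0"
    "\<And>x. \<exists>y. (\<forall>e. q e \<bullet> x = r e \<bullet> y) \<and> y \<bullet> y = (\<Sum>e\<in>UNIV. (q e \<bullet> x)\<^sup>2)"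
proof -
  define f :: "real ^ 'n \<Rightarrow> real ^ 'e" where "f x = (\<chi> e. q e \<bullet> x)" for x
  have "linear f"
    by (rule linearI) (simp_all add: f_def vec_eq_iff inner_add_right)
  then have "subspace (range f)"
    by (rule linear_subspace_image) simp
  then obtain B where B: "B \<subseteq> range f" "pairwise orthogonal B" "\<And>x. x \<in> B \<Longrightarrow> norm x = 1"
    "independent B" "card B = dim (range f)" "span B = range f"
    by (rule orthonormal_basis_subspace) blast
  have "finite B" using B(4) by (rule independent_imp_finite)
  have "card B \<le> CARD('n)"
    using dim_image_le[OF \<open>linear f\<close>, of UNIV] B(5) by simp
  \<comment> \<open>\<open>g\<close> labels the basis vectors by indices in \<open>'n\<close>; the
    dimension bound provides enough labels.\<close>
  then obtain g :: "real ^ 'e \<Rightarrow> 'n" where g: "inj_on g B"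
    using card_le_inj[OF \<open>finite B\<close>, of "UNIV :: 'n set"] by auto
  define I where "I = g ` B"
  define b where "b i = (if i \<in> I then inv_into B g i else 0)" for i
  have bB: "b i \<in> B" if "i \<in> I" for i
    using that by (simp add: b_def I_def inv_into_into)
  have b_inj: "b i \<noteq> b j" if "i \<in> I" "j \<in> I" "i \<noteq> j" for i j
    using that by (auto simp: b_def I_def inv_into_f_f[OF g])
  have ortho: "b i \<bullet> b j = (if i = j \<and> i \<in> I then 1 else 0)" for i j
  proof (cases "i \<in> I \<and> j \<in> I")
    case True
    then show ?thesis
      using B(2,3) bB b_inj unfolding pairwise_def orthogonal_def
      by (cases "i = j") (auto simp: dot_square_norm)
  qed (auto simp: b_def)
  define r :: "'e \<Rightarrow> real ^ 'n" where "r e = (\<chi> i. b i $ e)" for e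
  show thesis
  proof
    fix Y :: "real ^ 'n ^ 'n" assume Y: "pos_semidef Y"
    have diag: "Y $ i $ i \<ge> 0" for i
    proof -
      have "0 \<le> axis i 1 \<bullet> (Y *v axis i 1)" using Y unfolding pos_semidef_def by blast
      then show ?thesis by (simp add: inner_axis' matrix_vector_mult_basis column_def)
    qed
    have "(\<Sum>e\<in>UNIV. r e \<bullet> (Y *v r e))
        = (\<Sum>e\<in>UNIV. \<Sum>i\<in>UNIV. \<Sum>j\<in>UNIV. Y $ i $ j * (b i $ e * b j $ e))"
      by (simp add: r_def inner_vec_def matrix_vector_mult_def sum_distrib_left mult_ac)
    also have "\<dots> = (\<Sum>i\<in>UNIV. \<Sum>j\<in>UNIV. \<Sum>e\<in>UNIV. Y $ i $ j * (b i $ e * b j $ e))"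
      by (subst sum.swap, rule sum.cong[OF refl], rule sum.swap)
    also have "\<dots> = (\<Sum>i\<in>UNIV. \<Sum>j\<in>UNIV. Y $ i $ j * (b i \<bullet> b j))"
      by (simp add: inner_vec_def sum_distrib_left)
    \<comment> \<open>Orthonormality leaves only diagonal entries of \<open>Y\<close> with index in
      \<open>I\<close>; the missing ones are nonnegative.\<close>
    also have "\<dots> = (\<Sum>i\<in>UNIV. if i \<in> I then Y $ i $ i else 0)"
      by (rule sum.cong[OF refl]) (auto simp: ortho if_distrib if_distribR cong: if_cong)
    also have "\<dots> \<le> trace Y"
      unfolding trace_def by (intro sum_mono) (simp add: diag)
    finally show "(\<Sum>e\<in>UNIV. r e \<bullet> (Y *v r e)) \<le> trace Y" .
  next
    fix e assume "q e = 0"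
    have "b i $ e = 0" for i
    proof (cases "i \<in> I")
      case True
      then obtain x where "b i = f x" using bB B(1) by blast
      then show ?thesis by (simp add: f_def \<open>q e = 0\<close>)
    qed (simp add: b_def)
    then show "r e = 0" by (simp add: r_def vec_eq_iff)
  next
    fix x
    \<comment> \<open>The coordinates of \<open>f x\<close> in the padded basis; Parseval gives the
      length of \<open>y\<close>.\<close>
    define y :: "real ^ 'n" where "y = (\<chi> i. f x \<bullet> b i)"
    have I_eq: "(\<Sum>v\<in>B. h v) = (\<Sum>i\<in>I. h (b i))" for h :: "real ^ 'e \<Rightarrow> real ^ 'e"
      unfolding I_def sum.reindex[OF g]
      by (rule sum.cong) (simp_all add: b_def I_def inv_into_f_f[OF g])
    have "f x \<in> span B" using B(6) by simp
    then have "f x = (\<Sum>v\<in>B. (f x \<bullet> v) *\<^sub>R v)"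
      using orthonormal_basis_expand[OF B(2,3) _ \<open>finite B\<close>, of "f x"] by simp
    also have "\<dots> = (\<Sum>i\<in>I. (f x \<bullet> b i) *\<^sub>R b i)" by (rule I_eq)
    also have "\<dots> = (\<Sum>i\<in>UNIV. (f x \<bullet> b i) *\<^sub>R b i)"
      by (rule sum.mono_neutral_left) (auto simp: b_def)
    finally have fx: "f x = (\<Sum>i\<in>UNIV. (f x \<bullet> b i) *\<^sub>R b i)" .
    have "q e \<bullet> x = r e \<bullet> y" for e
    proof -
      have "q e \<bullet> x = f x $ e" by (simp add: f_def)
      also have "\<dots> = r e \<bullet> y"
        by (subst fx) (simp add: r_def y_def inner_vec_def mult.commute)
      finally show ?thesis .
    qed
    moreover have "y \<bullet> y = (\<Sum>e\<in>UNIV. (q e \<bullet> x)\<^sup>2)"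
    proof -
      have "y \<bullet> y = (\<Sum>i\<in>UNIV. (f x \<bullet> b i) * (f x \<bullet> b i))"
        by (simp add: y_def inner_vec_def)
      also have "\<dots> = f x \<bullet> (\<Sum>i\<in>UNIV. (f x \<bullet> b i) *\<^sub>R b i)"
        by (simp add: inner_sum_right)
      also have "\<dots> = f x \<bullet> f x" by (simp flip: fx)
      also have "\<dots> = (\<Sum>e\<in>UNIV. (q e \<bullet> x)\<^sup>2)"
        by (simp add: f_def inner_vec_def power2_eq_square)
      finally show ?thesis .
    qed
    ultimately show "\<exists>y. (\<forall>e. q e \<bullet> x = r e \<bullet> y) \<and> y \<bullet> y = (\<Sum>e\<in>UNIV. (q e \<bullet> x)\<^sup>2)"
      by blast
  qed
qed

section \<open>Growing a light vertex set\<close>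

text \<open>Not restricted to an edge set: in the application, pairs that are not edges carry the
  zero vector.\<close>

definition edges_inside :: "'v set \<Rightarrow> 'v uprod set" where
  "edges_inside S = {e. set_uprod e \<subseteq> S}"

definition slack :: "('v uprod \<Rightarrow> real ^ 'n) \<Rightarrow> 'v set \<Rightarrow> real \<Rightarrow> real ^ 'n ^ 'n" where
  "slack r S u = u *\<^sub>R mat 1 - gram r (edges_inside S)"

definition potential :: "('v uprod \<Rightarrow> real ^ 'n::finite) \<Rightarrow> 'v set \<Rightarrow> real \<Rightarrow> real" where
  "potential r S u = trace (matrix_inv (slack r S u)) - real CARD('n) / u"

text \<open>In the application \<open>r e \<bullet> r e\<close> is the leverage score of
  \<open>e\<close>, its weight times its effective resistance.\<close>

definition degree :: "('v uprod \<Rightarrow> real ^ 'n::finite) \<Rightarrow> 'v \<Rightarrow> real" where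
  "degree r s = (\<Sum>e | s \<in> set_uprod e. r e \<bullet> r e)"

section \<open>Elementary properties of the slack matrix\<close>

lemma inner_slack:
  fixes r :: "'v::finite uprod \<Rightarrow> real ^ 'n::finite"
  shows "x \<bullet> (slack r S u *v x) = u * (x \<bullet> x) - (\<Sum>e\<in>edges_inside S. (r e \<bullet> x)\<^sup>2)"
  by (simp add: slack_def matrix_vector_mult_diff_rdistrib scaleR_matrix_vector_mult
      inner_diff_right inner_gram power2_eq_square)

lemma transpose_slack: "transpose (slack r S u) = slack r S u"
proof -
  have "transpose (slack r S u) = u *\<^sub>R mat 1 - transpose (gram r (edges_inside S))"
    by (auto simp: slack_def transpose_def vec_eq_iff mat_def)
  then show ?thesis by (simp add: slack_def transpose_gram)
qed

lemma slack_shift: "slack r S (u + \<delta>) = slack r S u + \<delta> *\<^sub>R mat 1"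
  by (simp add: slack_def scaleR_add_left)

lemma pos_def_slack_mono:
  fixes r :: "'v::finite uprod \<Rightarrow> real ^ 'n::finite"
  assumes "pos_def (slack r S u)" "u \<le> u'"
  shows "pos_def (slack r S u')"
  unfolding pos_def_def
proof (intro conjI allI impI)
  fix x :: "real ^ 'n" assume "x \<noteq> 0"
  then have "0 < x \<bullet> (slack r S u *v x)" using assms(1) by (simp add: pos_def_def)
  moreover have "u * (x \<bullet> x) \<le> u' * (x \<bullet> x)" using assms(2) by (intro mult_right_mono) auto
  ultimately show "0 < x \<bullet> (slack r S u' *v x)" by (simp add: inner_slack)
qed (rule transpose_slack)

section \<open>Edge sums, boundaries and degrees\<close>

lemma gram_Un_disjoint:
  "finite F \<Longrightarrow> finite F' \<Longrightarrow> F \<inter> F' = {} \<Longrightarrow> gram r (F \<union> F') = gram r F + gram r F'"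
  by (simp add: gram_def sum.union_disjoint)

text \<open>The frame bound is applied to \<open>Z\<close> minus its scalar part, where positivity
  allows enlarging \<open>F\<close> to all edges. The scalar part is paid for on \<open>F\<close>
  only.\<close>

lemma frame_sum_le:
  fixes r :: "'e::finite \<Rightarrow> real ^ 'n::finite"
  assumes frame: "\<And>Y. pos_semidef Y \<Longrightarrow> (\<Sum>e\<in>UNIV. r e \<bullet> (Y *v r e)) \<le> trace Y"
    and Z: "pos_semidef (Z - c *\<^sub>R mat 1)"
  shows "(\<Sum>e\<in>F. r e \<bullet> (Z *v r e)) \<le> trace Z - c * real CARD('n) + c * (\<Sum>e\<in>F. r e \<bullet> r e)"
proof -
  have "(\<Sum>e\<in>F. r e \<bullet> (Z *v r e)) - c * (\<Sum>e\<in>F. r e \<bullet> r e)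
      = (\<Sum>e\<in>F. r e \<bullet> ((Z - c *\<^sub>R mat 1) *v r e))"
    by (simp add: matrix_vector_mult_diff_rdistrib scaleR_matrix_vector_mult inner_diff_right
        sum_subtractf sum_distrib_left)
  also have "\<dots> \<le> (\<Sum>e\<in>UNIV. r e \<bullet> ((Z - c *\<^sub>R mat 1) *v r e))"
    using Z unfolding pos_semidef_def by (intro sum_mono2) auto
  also have "\<dots> \<le> trace Z - c * real CARD('n)"
    using frame[OF Z] by (simp add: trace_sub trace_scaleR trace_I)
  finally show ?thesis by simp
qed

text \<open>An edge completed by a new vertex is either a loop, with zero vector, or has its other
  endpoint in \<open>S\<close> and is charged to that endpoint.\<close>

lemma boundary_sum_le:
  fixes r :: "'v::finite uprod \<Rightarrow> real ^ 'n::finite"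
  assumes loops: "\<And>s. r (Upair s s) = 0"
  shows "(\<Sum>e\<in>(\<Union>t\<in>T - S. edges_inside (insert t S) - edges_inside S). r e \<bullet> r e)
    \<le> (\<Sum>s\<in>S. degree r s)" (is "sum ?\<tau> ?F \<le> _")
proof -
  have "?\<tau> e \<le> (\<Sum>s\<in>S. if s \<in> set_uprod e then ?\<tau> e else 0)" if "e \<in> ?F" for e
  proof (cases "r e = 0")
    case False
    obtain a b where e: "e = Upair a b" by (cases e)
    with False loops have "a \<noteq> b" by auto
    with that e obtain s where s: "s \<in> S" "s \<in> set_uprod e"
      by (auto simp: edges_inside_def)
    have "?\<tau> e \<le> (if s \<in> set_uprod e then ?\<tau> e else 0)" using s by simp
    also have "\<dots> \<le> (\<Sum>s\<in>S. if s \<in> set_uprod e then ?\<tau> e else 0)"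
      by (rule member_le_sum) (use s in auto)
    finally show ?thesis .
  qed (simp add: sum_nonneg)
  then have "sum ?\<tau> ?F \<le> (\<Sum>e\<in>?F. \<Sum>s\<in>S. if s \<in> set_uprod e then ?\<tau> e else 0)"
    by (rule sum_mono)
  also have "\<dots> \<le> (\<Sum>e\<in>UNIV. \<Sum>s\<in>S. if s \<in> set_uprod e then ?\<tau> e else 0)"
    by (rule sum_mono2) (auto intro!: sum_nonneg)
  also have "\<dots> = (\<Sum>s\<in>S. degree r s)"
    by (subst sum.swap) (simp add: degree_def sum.If_cases)
  finally show ?thesis .
qed

text \<open>An edge has at most two endpoints, and the frame bound at the identity controls the
  total of the leverages.\<close>

lemma sum_degree_le:
  fixes r :: "'v::finite uprod \<Rightarrow> real ^ 'n::finite"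
  assumes frame: "\<And>Y. pos_semidef Y \<Longrightarrow> (\<Sum>e\<in>UNIV. r e \<bullet> (Y *v r e)) \<le> trace Y"
  shows "(\<Sum>s\<in>UNIV. degree r s) \<le> 2 * real CARD('n)"
proof -
  have "(\<Sum>s\<in>UNIV. degree r s) = (\<Sum>e\<in>UNIV. \<Sum>s\<in>UNIV. if s \<in> set_uprod e then r e \<bullet> r e else 0)"
    by (subst sum.swap) (simp add: degree_def sum.If_cases)
  also have "\<dots> = (\<Sum>e\<in>UNIV. real (card (set_uprod e)) * (r e \<bullet> r e))"
    by (simp add: sum.If_cases)
  also have "\<dots> \<le> (\<Sum>e\<in>UNIV. 2 * (r e \<bullet> r e))"
  proof (intro sum_mono mult_right_mono)
    fix e :: "'v uprod"
    show "real (card (set_uprod e)) \<le> 2"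
      by (cases e) (simp add: card_insert_if)
  qed simp
  also have "\<dots> \<le> 2 * real CARD('n)"
  proof -
    have "pos_semidef (mat 1 :: real ^ 'n ^ 'n)" by (simp add: pos_semidef_def)
    from frame[OF this] show ?thesis by (simp add: trace_I flip: sum_distrib_left)
  qed
  finally show ?thesis .
qed

text \<open>Averaging over \<open>T - S\<close> yields a \<open>t\<close> with
  \<open>\<theta> t + a t / m < 1\<close>, which is \<open>a t / (1 - \<theta> t) < m\<close> in
  disguise. In \<open>room\<close>, \<open>1 / \<delta>\<close> pays for the sum of
  \<open>a t / m\<close>, and the other two terms pay for the sum of
  \<open>\<theta> t\<close>.\<close>

lemma barrier_step:
  fixes r :: "'v::finite uprod \<Rightarrow> real ^ 'n::finite"
  assumes frame: "\<And>Y. pos_semidef Y \<Longrightarrow> (\<Sum>e\<in>UNIV. r e \<bullet> (Y *v r e)) \<le> trace Y"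
    and loops: "\<And>s. r (Upair s s) = 0"
    and pd: "pos_def (slack r S u)"
    and "u > 0" "\<delta> > 0" "\<kappa> > 0"
    and d: "(\<Sum>s\<in>S. degree r s) \<le> d"
    and \<kappa>: "\<delta> * d / (u + \<delta>)\<^sup>2 \<le> \<kappa>"
    and room: "1 / \<delta> + potential r S u + d / (u + \<delta>) < real (card (T - S))"
  obtains t where "t \<in> T - S" "pos_def (slack r (insert t S) (u + \<delta>))"
    "potential r (insert t S) (u + \<delta>) \<le> potential r S u + \<kappa>"
proof -
  define u' where "u' = u + \<delta>"
  have "u' > 0" using \<open>u > 0\<close> \<open>\<delta> > 0\<close> by (simp add: u'_def)
  define A where "A = slack r S u'"
  define X where "X = matrix_inv A"
  define Q where "Q = trace (X ** X) - real CARD('n) / u'\<^sup>2"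
  define new where "new t = edges_inside (insert t S) - edges_inside S" for t
  define \<theta> where "\<theta> t = (\<Sum>e\<in>new t. r e \<bullet> (X *v r e))" for t
  define a where "a t = (\<Sum>e\<in>new t. (X *v r e) \<bullet> (X *v r e))" for t
  define F where "F = (\<Union>t\<in>T - S. new t)"
  have A: "pos_def A"
    using pos_def_slack_mono[OF pd] \<open>\<delta> > 0\<close> by (simp add: A_def u'_def)
  have le: "x \<bullet> (slack r S v *v x) \<le> v * (x \<bullet> x)" for x v
    by (simp add: inner_slack sum_nonneg)
  have psd1: "pos_semidef (X - (1 / u') *\<^sub>R mat 1)"
    and psd2: "pos_semidef (X ** X - (1 / u'\<^sup>2) *\<^sub>R mat 1)"
    unfolding X_def using A \<open>u' > 0\<close> le unfolding A_def
    by (intro pos_semidef_inverse_minus; blast)+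
  have "Q \<ge> 0"
    using pos_semidef_trace_nonneg[OF psd2] by (simp add: Q_def trace_sub trace_scaleR trace_I)
  have shift: "trace X - real CARD('n) / u' + \<delta> * Q \<le> potential r S u"
    using barrier_shift[OF pd _ \<open>u > 0\<close> _ le, of \<delta>] A \<open>\<delta> > 0\<close>
    by (simp add: potential_def X_def Q_def A_def u'_def slack_shift)
  have XX: "r e \<bullet> (X ** X *v r e) = (X *v r e) \<bullet> (X *v r e)" for e
    unfolding X_def by (simp add: symmetric_inner[OF transpose_matrix_inv[OF A]]
        flip: matrix_vector_mul_assoc)
  have d': "(\<Sum>e\<in>F. r e \<bullet> r e) \<le> d"
    using boundary_sum_le[where r = r and S = S and T = T, OF loops] d by (simp add: F_def new_def)
  \<comment> \<open>An edge inside both enlargements of \<open>S\<close> avoids \<open>t\<close> and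
    \<open>t'\<close>, so it was inside \<open>S\<close> already.\<close>
  have "new t \<inter> new t' = {}" if "t \<noteq> t'" for t t'
    using that by (auto simp: new_def edges_inside_def)
  then have F_sum: "(\<Sum>t\<in>T - S. \<Sum>e\<in>new t. f e) = (\<Sum>e\<in>F. f e)" for f :: "'v uprod \<Rightarrow> real"
    unfolding F_def by (intro sum.UNION_disjoint[symmetric]) auto
  have sum_\<theta>: "(\<Sum>t\<in>T - S. \<theta> t) \<le> potential r S u + d / u'"
  proof -
    have "(\<Sum>t\<in>T - S. \<theta> t) \<le> trace X - real CARD('n) / u' + (\<Sum>e\<in>F. r e \<bullet> r e) / u'"
      using frame_sum_le[OF frame psd1, of F] by (simp add: \<theta>_def F_sum)
    also have "(\<Sum>e\<in>F. r e \<bullet> r e) / u' \<le> d / u'"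
      using d' \<open>u' > 0\<close> by (intro divide_right_mono) auto
    also have "trace X - real CARD('n) / u' \<le> potential r S u"
      using shift \<open>Q \<ge> 0\<close> \<open>\<delta> > 0\<close> mult_nonneg_nonneg[of \<delta> Q] by linarith
    finally show ?thesis by simp
  qed
  have sum_a: "(\<Sum>t\<in>T - S. a t) \<le> Q + d / u'\<^sup>2"
  proof -
    have "(\<Sum>t\<in>T - S. a t) \<le> Q + (\<Sum>e\<in>F. r e \<bullet> r e) / u'\<^sup>2"
      using frame_sum_le[OF frame psd2, of F] by (simp add: a_def F_sum Q_def XX)
    also have "(\<Sum>e\<in>F. r e \<bullet> r e) / u'\<^sup>2 \<le> d / u'\<^sup>2"
      using d' by (intro divide_right_mono) auto
    finally show ?thesis by simp
  qed
  \<comment> \<open>The budget for adding a vertex: what raising the barrier releases, plus the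
    permitted rise \<kappa> of the potential.\<close>
  define m where "m = \<delta> * Q + \<kappa>"
  have "m > 0"
    using \<open>Q \<ge> 0\<close> \<open>\<delta> > 0\<close> \<open>\<kappa> > 0\<close> by (simp add: m_def add_nonneg_pos)
  have "\<exists>t\<in>T - S. \<theta> t + a t / m < 1"
  proof (rule ccontr)
    assume "\<not> ?thesis"
    then have "(\<Sum>t\<in>T - S. 1) \<le> (\<Sum>t\<in>T - S. \<theta> t + a t / m)"
      by (intro sum_mono) (auto simp: not_less)
    then have "real (card (T - S)) \<le> (\<Sum>t\<in>T - S. \<theta> t) + (\<Sum>t\<in>T - S. a t) / m"
      by (simp add: sum.distrib sum_divide_distrib)
    also have "(\<Sum>t\<in>T - S. a t) / m \<le> 1 / \<delta>"
    proof -
      have "\<delta> * (\<Sum>t\<in>T - S. a t) \<le> \<delta> * (Q + d / u'\<^sup>2)"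
        using sum_a \<open>\<delta> > 0\<close> by (intro mult_left_mono) auto
      also have "\<dots> \<le> m" using \<kappa> by (simp add: m_def u'_def distrib_left)
      finally show ?thesis using \<open>m > 0\<close> \<open>\<delta> > 0\<close> by (simp add: field_simps)
    qed
    finally show False using sum_\<theta> room by (simp add: u'_def)
  qed
  then obtain t where t: "t \<in> T - S" "\<theta> t + a t / m < 1" by blast
  have "a t \<ge> 0" unfolding a_def by (intro sum_nonneg) auto
  then have "\<theta> t < 1" using t(2) \<open>m > 0\<close> divide_nonneg_pos[of "a t" m] by linarith
  have "edges_inside (insert t S) = edges_inside S \<union> new t"
    by (auto simp: new_def edges_inside_def)
  moreover have "gram r (edges_inside S \<union> new t) = gram r (edges_inside S) + gram r (new t)"
    by (rule gram_Un_disjoint) (auto simp: new_def)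
  ultimately have slack: "slack r (insert t S) u' = A - gram r (new t)"
    by (simp add: slack_def A_def)
  have small: "(\<Sum>e\<in>new t. r e \<bullet> (matrix_inv A *v r e)) < 1"
    using \<open>\<theta> t < 1\<close> by (simp add: \<theta>_def X_def)
  have "trace (matrix_inv (slack r (insert t S) u')) \<le> trace X + a t / (1 - \<theta> t)"
    using gram_update(2)[OF A small] by (simp add: slack a_def \<theta>_def X_def)
  also have "a t / (1 - \<theta> t) \<le> m"
    using t(2) \<open>\<theta> t < 1\<close> \<open>m > 0\<close> by (simp add: field_simps)
  finally have "potential r (insert t S) u' \<le> potential r S u + \<kappa>"
    using shift by (simp add: potential_def m_def)
  moreover have "pos_def (slack r (insert t S) u')"
    using gram_update(1)[OF A small] by (simp add: slack)
  ultimately show thesis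
    using that[OF t(1)] by (simp add: u'_def)
qed

lemma matrix_inv_scaleR_mat:
  assumes "u > 0"
  shows "pos_def (u *\<^sub>R mat 1 :: real ^ 'n ^ 'n::finite)"
    and "matrix_inv (u *\<^sub>R mat 1 :: real ^ 'n ^ 'n) = (1 / u) *\<^sub>R mat 1"
proof -
  have "transpose (u *\<^sub>R mat 1 :: real ^ 'n ^ 'n) = u *\<^sub>R mat 1"
    by (auto simp: transpose_def vec_eq_iff mat_def)
  then show pd: "pos_def (u *\<^sub>R mat 1 :: real ^ 'n ^ 'n)"
    using assms by (simp add: pos_def_def scaleR_matrix_vector_mult)
  have "u *\<^sub>R matrix_inv (u *\<^sub>R mat 1 :: real ^ 'n ^ 'n) = mat 1"
    using matrix_inv_mult(1)[OF pd] by (simp flip: scalar_matrix_assoc)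
  then have "(1 / u) *\<^sub>R (u *\<^sub>R matrix_inv (u *\<^sub>R mat 1 :: real ^ 'n ^ 'n)) = (1 / u) *\<^sub>R mat 1"
    by simp
  then show "matrix_inv (u *\<^sub>R mat 1 :: real ^ 'n ^ 'n) = (1 / u) *\<^sub>R mat 1"
    using assms by simp
qed

lemma exists_light_set:
  fixes r :: "'v::finite uprod \<Rightarrow> real ^ 'v"
  assumes frame: "\<And>Y. pos_semidef Y \<Longrightarrow> (\<Sum>e\<in>UNIV. r e \<bullet> (Y *v r e)) \<le> trace Y"
    and loops: "\<And>s. r (Upair s s) = 0"
    and "0 < \<epsilon>" "\<epsilon> < 1"
  obtains S :: "'v set" where "real (card S) \<ge> \<epsilon> * real CARD('v) / 42"
    "\<forall>y. (\<Sum>e\<in>edges_inside S. (r e \<bullet> y)\<^sup>2) \<le> \<epsilon> * (y \<bullet> y)"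
proof -
  \<comment> \<open>A barrier moving from \<open>\<epsilon> / 2\<close> to \<open>\<epsilon>\<close> in \<open>x\<close> steps advances by \<open>\<delta>\<close>. At most half of the vertices
    have degree above 4; with \<open>T\<close> the others, each step costs a potential of at most
    \<open>4 x \<delta> / (\<epsilon> / 2)\<^sup>2 = 8 / \<epsilon>\<close>, and of the at least \<open>10 n / 21\<close> candidates in \<open>T - S\<close>
    only \<open>n / 21 + 4 n / 21 + 4 n / 21\<close> are excluded on average.\<close>
  define n where "n = real CARD('v)"
  define x where "x = \<epsilon> * n / 42"
  define \<delta> where "\<delta> = 21 / n"
  define T where "T = {s. degree r s \<le> 4}"
  have "n > 0" by (simp add: n_def)
  then have "\<delta> > 0" "x > 0" "x \<le> n / 42" "x * \<delta> = \<epsilon> / 2"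
    using \<open>0 < \<epsilon>\<close> \<open>\<epsilon> < 1\<close> by (simp_all add: \<delta>_def x_def)
  have deg_nonneg: "degree r s \<ge> 0" for s
    by (simp add: degree_def sum_nonneg)
  have T: "n / 2 \<le> real (card T)"
  proof -
    have "4 * real (card (- T)) = (\<Sum>s\<in>- T. 4)" by simp
    also have "\<dots> \<le> (\<Sum>s\<in>- T. degree r s)"
      by (intro sum_mono) (auto simp: T_def)
    also have "\<dots> \<le> (\<Sum>s\<in>UNIV. degree r s)"
      by (intro sum_mono2) (auto simp: deg_nonneg)
    also have "\<dots> \<le> 2 * n"
      using sum_degree_le[OF frame] by (simp add: n_def)
    finally have "2 * real (card (- T)) \<le> n" by simp
    moreover have "real (card T) + real (card (- T)) = n"
      using card_Un_disjoint[of T "- T"] by (simp add: n_def)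
    ultimately show ?thesis by linarith
  qed
  \<comment> \<open>The start is a singleton, which contains only a loop and so has potential 0. The
    extra vertex lets \<open>x\<close> be rounded down: the final size still exceeds
    \<open>x\<close>, and the barrier does not pass \<epsilon>.\<close>
  have "\<exists>S\<subseteq>T. card S = Suc i \<and> pos_def (slack r S (\<epsilon> / 2 + i * \<delta>))
      \<and> potential r S (\<epsilon> / 2 + i * \<delta>) \<le> i * (8 / \<epsilon>)" if "real i \<le> x" for i
    using that
  proof (induction i)
    case 0
    have "card T > 0" using T \<open>n > 0\<close> by linarith
    then obtain t where "t \<in> T" by fastforce
    have "edges_inside {t} = {Upair t t}"
    proof (intro equalityI subsetI)
      fix e assume "e \<in> edges_inside {t}"
      then show "e \<in> {Upair t t}" by (cases e) (auto simp: edges_inside_def)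
    qed (auto simp: edges_inside_def)
    then have "slack r {t} (\<epsilon> / 2) = (\<epsilon> / 2) *\<^sub>R mat 1"
      by (simp add: slack_def gram_def loops outer_product_def vec_eq_iff)
    then have "pos_def (slack r {t} (\<epsilon> / 2))" "potential r {t} (\<epsilon> / 2) = 0"
      using matrix_inv_scaleR_mat[of "\<epsilon> / 2", where 'n = 'v] \<open>0 < \<epsilon>\<close>
      by (simp_all add: potential_def trace_scaleR trace_I)
    then show ?case using \<open>t \<in> T\<close> by (intro exI[of _ "{t}"]) simp
  next
    case (Suc i)
    then obtain S where S: "S \<subseteq> T" "card S = Suc i" "pos_def (slack r S (\<epsilon> / 2 + i * \<delta>))"
      "potential r S (\<epsilon> / 2 + i * \<delta>) \<le> i * (8 / \<epsilon>)"
      by auto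
    define u where "u = \<epsilon> / 2 + i * \<delta>"
    have u: "\<epsilon> / 2 \<le> u" "\<epsilon> / 2 \<le> u + \<delta>" using \<open>\<delta> > 0\<close> by (simp_all add: u_def)
    \<comment> \<open>Before the step \<open>S\<close> has \<open>Suc i\<close> vertices, and the
      premise bounds exactly this number by \<open>x\<close>.\<close>
    have d: "(\<Sum>s\<in>S. degree r s) \<le> 4 * x"
    proof -
      have "(\<Sum>s\<in>S. degree r s) \<le> (\<Sum>s\<in>S. 4)"
        using S(1) by (intro sum_mono) (auto simp: T_def)
      then show ?thesis using S(2) Suc.prems by simp
    qed
    have \<kappa>: "\<delta> * (4 * x) / (u + \<delta>)\<^sup>2 \<le> 8 / \<epsilon>"
    proof -
      have "\<delta> * (4 * x) / (u + \<delta>)\<^sup>2 \<le> \<delta> * (4 * x) / (\<epsilon> / 2)\<^sup>2"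
        using u \<open>\<delta> > 0\<close> \<open>x > 0\<close> \<open>0 < \<epsilon>\<close>
        by (intro divide_left_mono power_mono mult_pos_pos zero_less_power) auto
      also have "\<dots> = 4 * (x * \<delta>) / (\<epsilon> / 2)\<^sup>2" by simp
      also have "\<dots> = 8 / \<epsilon>"
        unfolding \<open>x * \<delta> = \<epsilon> / 2\<close> using \<open>0 < \<epsilon>\<close> by (simp add: power2_eq_square field_simps)
      finally show ?thesis .
    qed
    have room: "1 / \<delta> + potential r S u + 4 * x / (u + \<delta>) < real (card (T - S))"
    proof -
      have "potential r S u \<le> x * (8 / \<epsilon>)"
        using S(4) Suc.prems \<open>0 < \<epsilon>\<close> mult_right_mono[of i x "8 / \<epsilon>"] by (simp add: u_def)
      also have "\<dots> = 4 * n / 21" using \<open>0 < \<epsilon>\<close> by (simp add: x_def)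
      finally have "potential r S u \<le> 4 * n / 21" .
      moreover have "4 * x / (u + \<delta>) \<le> 4 * x / (\<epsilon> / 2)"
        using u \<open>x > 0\<close> \<open>0 < \<epsilon>\<close> by (intro divide_left_mono) auto
      moreover have "4 * x / (\<epsilon> / 2) = 4 * n / 21" using \<open>0 < \<epsilon>\<close> by (simp add: x_def)
      moreover have "1 / \<delta> = n / 21" by (simp add: \<delta>_def)
      moreover have "real (card (T - S)) = real (card T) - real (Suc i)"
        using S(1,2) by (simp add: card_Diff_subset of_nat_diff card_mono flip: S(2))
      ultimately show ?thesis
        using T Suc.prems \<open>x \<le> n / 42\<close> \<open>n > 0\<close> by linarith
    qed
    have "0 < u" "0 < 8 / \<epsilon>" using u \<open>0 < \<epsilon>\<close> by auto
    obtain t where t: "t \<in> T - S" "pos_def (slack r (insert t S) (u + \<delta>))"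
      "potential r (insert t S) (u + \<delta>) \<le> potential r S u + 8 / \<epsilon>"
      using barrier_step[OF frame loops S(3)[folded u_def] \<open>0 < u\<close> \<open>0 < \<delta>\<close> \<open>0 < 8 / \<epsilon>\<close> d \<kappa> room]
      by blast
    have "u + \<delta> = \<epsilon> / 2 + Suc i * \<delta>" by (simp add: u_def algebra_simps)
    moreover have "potential r S u + 8 / \<epsilon> \<le> Suc i * (8 / \<epsilon>)"
      using S(4) by (simp add: u_def algebra_simps add_divide_distrib)
    ultimately show ?case
      using t S(1,2) by (intro exI[of _ "insert t S"]) auto
  qed
  from this[of "nat \<lfloor>x\<rfloor>"] obtain S where S: "card S = Suc (nat \<lfloor>x\<rfloor>)"
    "pos_def (slack r S (\<epsilon> / 2 + nat \<lfloor>x\<rfloor> * \<delta>))"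
    using \<open>x > 0\<close> by fastforce
  have "real (nat \<lfloor>x\<rfloor>) * \<delta> \<le> x * \<delta>"
    using \<open>x > 0\<close> \<open>\<delta> > 0\<close> by (intro mult_right_mono) auto
  then have "pos_def (slack r S \<epsilon>)"
    using pos_def_slack_mono[OF S(2)] \<open>x * \<delta> = \<epsilon> / 2\<close> by simp
  from pos_def_nonneg[OF this]
  have "(\<Sum>e\<in>edges_inside S. (r e \<bullet> y)\<^sup>2) \<le> \<epsilon> * (y \<bullet> y)" for y
    by (simp add: inner_slack)
  moreover have "real (card S) \<ge> \<epsilon> * real CARD('v) / 42"
    using S(1) \<open>x > 0\<close> unfolding x_def n_def by simp linarith
  ultimately show thesis using that by blast
qed

section \<open>Laplacians\<close>

text \<open>Selects an orientation of each edge; the sign disappears in the outer product.\<close>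

lemma exists_incidence_vector:
  "\<exists>d :: real ^ 'v. edge_matrix e = outer_product d d \<and> (\<forall>s. e = Upair s s \<longrightarrow> d = 0)"
  for e :: "'v::finite uprod"
proof (cases e)
  case (Upair a b)
  then show ?thesis
    by (intro exI[of _ "axis a 1 - axis b 1"]) (auto simp: edge_matrix_Upair)
qed

lemma transpose_edge_matrix: "transpose (edge_matrix e) = edge_matrix e"
  using exists_incidence_vector[of e] by (auto simp: transpose_outer_product)

lemma transpose_laplacian: "transpose (laplacian E w) = laplacian E w"
proof -
  have "transpose (w e *\<^sub>R edge_matrix e) = w e *\<^sub>R edge_matrix e" for e
    using transpose_edge_matrix[of e] by (simp add: transpose_def vec_eq_iff)
  then show ?thesis by (simp add: laplacian_def transpose_sum)
qed

theorem lemmaB1: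
  fixes E :: "'v::finite uprod set"
    and w :: "'v uprod \<Rightarrow> real"
    and \<epsilon> :: real
  assumes "\<And>e. e \<in> E \<Longrightarrow> w e > 0"
    and "0 < \<epsilon>" and "\<epsilon> < 1"
  shows "\<exists>S :: 'v set. real (card S) \<ge> \<epsilon> * real CARD('v) / 42 \<and>
           pos_semidef (\<epsilon> *\<^sub>R laplacian E w - laplacian (edges_within E S) w)"
proof -
  obtain d :: "'v uprod \<Rightarrow> real ^ 'v" where d: "\<And>e. edge_matrix e = outer_product (d e) (d e)"
    "\<And>s. d (Upair s s) = 0"
    using exists_incidence_vector by metis
  \<comment> \<open>Extension by zero lets all sums run over the full type of pairs and confines the
    square root to positive weights.\<close>
  define q where "q e = (if e \<in> E then sqrt (w e) *\<^sub>R d e else 0)" for e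
  have quad: "x \<bullet> (laplacian F w *v x) = (\<Sum>e\<in>F. (q e \<bullet> x)\<^sup>2)" if "F \<subseteq> E" for F x
  proof -
    have "x \<bullet> (laplacian F w *v x) = (\<Sum>e\<in>F. w e * (d e \<bullet> x)\<^sup>2)"
      by (simp add: laplacian_def sum_matrix_vector_mult scaleR_matrix_vector_mult d(1)
          outer_product_mult_vec inner_sum_right power2_eq_square inner_commute mult_ac)
    also have "\<dots> = (\<Sum>e\<in>F. (q e \<bullet> x)\<^sup>2)"
      using that assms(1) by (intro sum.cong) (auto simp: q_def power_mult_distrib less_imp_le)
    finally show ?thesis .
  qed
  obtain r :: "'v uprod \<Rightarrow> real ^ 'v" where r:
    "\<And>Y. pos_semidef Y \<Longrightarrow> (\<Sum>e\<in>UNIV. r e \<bullet> (Y *v r e)) \<le> trace Y"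
    "\<And>e. q e = 0 \<Longrightarrow> r e = 0"
    "\<And>x. \<exists>y. (\<forall>e. q e \<bullet> x = r e \<bullet> y) \<and> y \<bullet> y = (\<Sum>e\<in>UNIV. (q e \<bullet> x)\<^sup>2)"
    by (rule isotropic_position[of q]) blast
  have loops: "r (Upair s s) = 0" for s
    using r(2) by (simp add: q_def d(2))
  obtain S :: "'v set" where S: "real (card S) \<ge> \<epsilon> * real CARD('v) / 42"
    "\<forall>y. (\<Sum>e\<in>edges_inside S. (r e \<bullet> y)\<^sup>2) \<le> \<epsilon> * (y \<bullet> y)"
    by (rule exists_light_set[OF r(1) loops assms(2,3)]) blast
  have "pos_semidef (\<epsilon> *\<^sub>R laplacian E w - laplacian (edges_within E S) w)"
    unfolding pos_semidef_def
  proof (intro conjI allI)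
    have "transpose (\<epsilon> *\<^sub>R A - B) = \<epsilon> *\<^sub>R transpose A - transpose B" for A B :: "real ^ 'v ^ 'v"
      by (simp add: transpose_def vec_eq_iff)
    then show "transpose (\<epsilon> *\<^sub>R laplacian E w - laplacian (edges_within E S) w)
        = \<epsilon> *\<^sub>R laplacian E w - laplacian (edges_within E S) w"
      by (simp add: transpose_laplacian)
    fix x :: "real ^ 'v"
    \<comment> \<open>In the coordinates \<open>y\<close> the form of the whole Laplacian at
      \<open>x\<close> becomes \<open>y \<bullet> y\<close>, so the bound for \<open>S\<close>
      transfers back.\<close>
    obtain y where y: "\<And>e. q e \<bullet> x = r e \<bullet> y" "y \<bullet> y = (\<Sum>e\<in>UNIV. (q e \<bullet> x)\<^sup>2)"
      using r(3) by blast
    have "x \<bullet> (laplacian (edges_within E S) w *v x) = (\<Sum>e\<in>edges_within E S. (r e \<bullet> y)\<^sup>2)"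
      by (subst quad) (auto simp: edges_within_def y(1))
    also have "\<dots> \<le> (\<Sum>e\<in>edges_inside S. (r e \<bullet> y)\<^sup>2)"
      by (rule sum_mono2) (auto simp: edges_within_def edges_inside_def)
    also have "\<dots> \<le> \<epsilon> * (y \<bullet> y)" using S(2) by blast
    also have "y \<bullet> y = (\<Sum>e\<in>E. (q e \<bullet> x)\<^sup>2)"
      unfolding y(2) by (rule sum.mono_neutral_right) (auto simp: q_def)
    also have "\<dots> = x \<bullet> (laplacian E w *v x)" by (simp add: quad)
    finally show "0 \<le> x \<bullet> ((\<epsilon> *\<^sub>R laplacian E w - laplacian (edges_within E S) w) *v x)"
      by (simp add: matrix_vector_mult_diff_rdistrib scaleR_matrix_vector_mult inner_diff_right)
  qed
  with S(1) show ?thesis by blast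
qed

end
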